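(* Let $\mathfrak g$ be an $n$-Lie algebra, $V$ a vector space, and $\Omega=(\rho_{\mathfrak g},\rho_V,\vartheta_V,\vartheta_{\mathfrak g},\omega,\{-,\dots,-\}_V)$ an extreme action datum of $\mathfrak g$ through $V$, with associated functions $G,H$ and operation $[x_1+u_1,\dots,x_n+u_n]_\Omega=G(x_1,u_1;\dots;x_n,u_n)+H(x_1,u_1;\dots;x_n,u_n)$ on $\mathfrak g\oplus V$. For $x_1,\dots,x_{n-1},y_1,\dots,y_n\in\mathfrak g$ and $u_1,\dots,u_{n-1},v_1,\dots,v_n\in V$ put $$G_0=G(y_1,v_1;\dots;y_n,v_n),\quad H_0=H(y_1,v_1;\dots;y_n,v_n),$$ $$G_i=G(x_1,u_1;\dots;x_{n-1},u_{n-1};y_i,v_i),\quad H_i=H(x_1,u_1;\dots;x_{n-1},u_{n-1};y_i,v_i)\quad(1\le i\le n).$$ Then $[-,\dots,-]_\Omega$ is an $n$-Lie bracket on $\mathfrak g\oplus V$ if and only if for all such elements $$G(x_1,u_1;\dots;x_{n-1},u_{n-1};G_0,H_0)=\sum_{i=1}^nG(y_1,v_1;\dots;y_{i-1},v_{i-1};G_i,H_i;y_{i+1},v_{i+1};\dots;y_n,v_n),$$ $$H(x_1,u_1;\dots;x_{n-1},u_{n-1};G_0,H_0)=\sum_{i=1}^nH(y_1,v_1;\dots;y_{i-1},v_{i-1};G_i,H_i;y_{i+1},v_{i+1};\dots;y_n,v_n).$$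
   Context: $K$ is a field of characteristic zero; vector spaces are over $K$, all maps are linear; $n\ge2$. An $n$-Lie algebra is a vector space with an alternating $n$-linear bracket satisfying the Filippov identity $[z_1,\dots,z_{n-1},[w_1,\dots,w_n]]=\sum_{i=1}^n[w_1,\dots,w_{i-1},[z_1,\dots,z_{n-1},w_i],w_{i+1},\dots,w_n]$; such a bracket is called an $n$-Lie bracket. An extreme action datum of $\mathfrak g$ through $V$ is a sextuple $\Omega$ of linear maps, with no identities imposed: $\rho_{\mathfrak g}:\bigwedge^{n-1}\mathfrak g\to\mathrm{End}(V)$, $\rho_V:\bigwedge^{n-1}V\to\mathrm{End}(\mathfrak g)$, $\vartheta_V:V\to\mathrm{Hom}(\bigwedge^{n-1}\mathfrak g,\mathfrak g)$, $\vartheta_{\mathfrak g}:\mathfrak g\to\mathrm{Hom}(\bigwedge^{n-1}V,V)$, $\omega:\bigwedge^nV\to\mathfrak g$, $\{-,\dots,-\}_V:\bigwedge^nV\to V$. For $x_i\in\mathfrak g$, $u_i\in V$ define $$\begin{aligned}G(x_1,u_1;\dots;x_n,u_n)={}&[x_1,\dots,x_n]_{\mathfrak g}+\omega(u_1,\dots,u_n)+\sum_{i=1}^n(-1)^{i-1}\vartheta_V(u_i)(x_1,\dots,\widehat{x_i},\dots,x_n)\\&+\sum_{i=1}^n(-1)^{n-i}\rho_V(u_1,\dots,\widehat{u_i},\dots,u_n)x_i\in\mathfrak g,\\ H(x_1,u_1;\dots;x_n,u_n)={}&\{u_1,\dots,u_n\}_V+\sum_{i=1}^n(-1)^{n-i}\rho_{\mathfrak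 g}(x_1,\dots,\widehat{x_i},\dots,x_n)u_i\\&+\sum_{i=1}^n(-1)^{n-i}\vartheta_{\mathfrak g}(x_i)(u_1,\dots,\widehat{u_i},\dots,u_n)\in V.\end{aligned}$$ *)

theory Defs
  imports "HOL-Analysis.Product_Vector"
begin

text \<open>
  A vector space over the field \<open>'k\<close> is a type with a scalar multiplication \<open>s\<close>
  satisfying \<^const>\<open>vector_space\<close>. A \<open>k\<close>-tuple is a list of length \<open>k\<close>, indexed from \<open>0\<close>,
  so an index \<open>i\<close> counted from \<open>1\<close> becomes \<open>i - 1\<close>; values of tuple functions on lists of any
  other length are irrelevant.
\<close>

text \<open>
  A linear map from the \<open>k\<close>-th exterior power of a space is given by the corresponding alternating
  \<open>k\<close>-linear map, that is by its values on decomposable elements.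
\<close>

definition alternating_multilinear ::
  "nat \<Rightarrow> ('k::field \<Rightarrow> 'a::ab_group_add \<Rightarrow> 'a) \<Rightarrow> ('k \<Rightarrow> 'b::ab_group_add \<Rightarrow> 'b) \<Rightarrow> ('a list \<Rightarrow> 'b) \<Rightarrow> bool"
  where "alternating_multilinear k s1 s2 f \<longleftrightarrow>
    (\<forall>xs i. length xs = k \<longrightarrow> i < k \<longrightarrow> Vector_Spaces.linear s1 s2 (\<lambda>x. f (xs[i := x]))) \<and>
    (\<forall>xs i j. length xs = k \<longrightarrow> i < j \<longrightarrow> j < k \<longrightarrow> xs ! i = xs ! j \<longrightarrow> f xs = 0)"

definition n_Lie_bracket ::
  "nat \<Rightarrow> ('k::field \<Rightarrow> 'a::ab_group_add \<Rightarrow> 'a) \<Rightarrow> ('a list \<Rightarrow> 'a) \<Rightarrow> bool"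
  where "n_Lie_bracket n s br \<longleftrightarrow>
    alternating_multilinear n s s br \<and>
    (\<forall>zs ws. length zs = n - 1 \<longrightarrow> length ws = n \<longrightarrow>
      br (zs @ [br ws]) = (\<Sum>i<n. br (ws[i := br (zs @ [ws ! i])])))"

locale n_Lie_algebra = vector_space scale
  for scale :: "'k::field_char_0 \<Rightarrow> 'a::ab_group_add \<Rightarrow> 'a" +
  fixes n :: nat and bracket :: "'a list \<Rightarrow> 'a"
  assumes n_ge_2: "2 \<le> n"
    and n_Lie_bracket: "n_Lie_bracket n scale bracket"

record ('g, 'v) action_datum =
  rho_g :: "'g list \<Rightarrow> 'v \<Rightarrow> 'v"
  rho_V :: "'v list \<Rightarrow> 'g \<Rightarrow> 'g"
  theta_V :: "'v \<Rightarrow> 'g list \<Rightarrow> 'g"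
  theta_g :: "'g \<Rightarrow> 'v list \<Rightarrow> 'v"
  omega :: "'v list \<Rightarrow> 'g"
  curly_V :: "'v list \<Rightarrow> 'v"

text \<open>
  The vector space structure of the spaces \<open>End\<close> and \<open>Hom\<close> is pointwise, so linearity (or alternating
  multilinearity) of a map into such a space is required after evaluation.
\<close>

definition extreme_action_datum ::
  "nat \<Rightarrow> ('k::field \<Rightarrow> 'g::ab_group_add \<Rightarrow> 'g) \<Rightarrow> ('k \<Rightarrow> 'v::ab_group_add \<Rightarrow> 'v) \<Rightarrow>
    ('g, 'v) action_datum \<Rightarrow> bool"
  where "extreme_action_datum n sg sV \<Omega> \<longleftrightarrow>
    (\<forall>xs. length xs = n - 1 \<longrightarrow> Vector_Spaces.linear sV sV (rho_g \<Omega> xs)) \<and>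
    (\<forall>u. alternating_multilinear (n - 1) sg sV (\<lambda>xs. rho_g \<Omega> xs u)) \<and>
    (\<forall>us. length us = n - 1 \<longrightarrow> Vector_Spaces.linear sg sg (rho_V \<Omega> us)) \<and>
    (\<forall>x. alternating_multilinear (n - 1) sV sg (\<lambda>us. rho_V \<Omega> us x)) \<and>
    (\<forall>u. alternating_multilinear (n - 1) sg sg (theta_V \<Omega> u)) \<and>
    (\<forall>xs. length xs = n - 1 \<longrightarrow> Vector_Spaces.linear sV sg (\<lambda>u. theta_V \<Omega> u xs)) \<and>
    (\<forall>x. alternating_multilinear (n - 1) sV sV (theta_g \<Omega> x)) \<and>
    (\<forall>us. length us = n - 1 \<longrightarrow> Vector_Spaces.linear sg sV (\<lambda>x. theta_g \<Omega> x us)) \<and>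
    alternating_multilinear n sV sg (omega \<Omega>) \<and>
    alternating_multilinear n sV sV (curly_V \<Omega>)"

definition omit :: "nat \<Rightarrow> 'a list \<Rightarrow> 'a list"
  where "omit i xs = take i xs @ drop (Suc i) xs"

text \<open>
  The argument \<open>ps\<close> is the list of the pairs \<open>(x\<^sub>i, u\<^sub>i)\<close>. After the index shift, the signs
  with exponents \<open>i - 1\<close> and \<open>n - i\<close> have exponents \<open>i\<close> and \<open>n - 1 - i\<close>.
\<close>

definition action_G ::
  "nat \<Rightarrow> ('k::field \<Rightarrow> 'g::ab_group_add \<Rightarrow> 'g) \<Rightarrow> ('g list \<Rightarrow> 'g) \<Rightarrow>
    ('g, 'v) action_datum \<Rightarrow> ('g \<times> 'v) list \<Rightarrow> 'g"
  where "action_G n sg br \<Omega> ps = (let xs = map fst ps; us = map snd ps in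
    br xs + omega \<Omega> us
    + (\<Sum>i<n. sg ((- 1) ^ i) (theta_V \<Omega> (us ! i) (omit i xs)))
    + (\<Sum>i<n. sg ((- 1) ^ (n - 1 - i)) (rho_V \<Omega> (omit i us) (xs ! i))))"

definition action_H ::
  "nat \<Rightarrow> ('k::field \<Rightarrow> 'v::ab_group_add \<Rightarrow> 'v) \<Rightarrow>
    ('g, 'v) action_datum \<Rightarrow> ('g \<times> 'v) list \<Rightarrow> 'v"
  where "action_H n sV \<Omega> ps = (let xs = map fst ps; us = map snd ps in
    curly_V \<Omega> us
    + (\<Sum>i<n. sV ((- 1) ^ (n - 1 - i)) (rho_g \<Omega> (omit i xs) (us ! i)))
    + (\<Sum>i<n. sV ((- 1) ^ (n - 1 - i)) (theta_g \<Omega> (xs ! i) (omit i us))))"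

text \<open>The direct sum of \<open>\<gg>\<close> and \<open>V\<close> is the product type, \<open>x + u\<close> being \<open>(x, u)\<close>.\<close>

definition action_bracket ::
  "nat \<Rightarrow> ('k::field \<Rightarrow> 'g::ab_group_add \<Rightarrow> 'g) \<Rightarrow> ('k \<Rightarrow> 'v::ab_group_add \<Rightarrow> 'v) \<Rightarrow>
    ('g list \<Rightarrow> 'g) \<Rightarrow> ('g, 'v) action_datum \<Rightarrow> ('g \<times> 'v) list \<Rightarrow> 'g \<times> 'v"
  where "action_bracket n sg sV br \<Omega> ps = (action_G n sg br \<Omega> ps, action_H n sV \<Omega> ps)"

end

theory Submission
  imports Defs
begin

text \<open>
  The two displayed equations are the \<open>\<gg>\<close>- and \<open>V\<close>-components of the Filippov identity of
  \<open>[-,\<dots>,-]\<^sub>\<Omega>\<close>, because the bracket is the pair \<open>(G, H)\<close> and equations and sums in \<open>\<gg> \<oplus> V\<close> are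
  componentwise. The content of the theorem is therefore that \<open>[-,\<dots>,-]\<^sub>\<Omega>\<close> is alternating and
  multilinear for every datum.

  The terms without a sign, the bracket of \<open>\<gg>\<close>, \<open>\<omega>\<close> and \<open>{-,\<dots>,-}\<^sub>V\<close>, are alternating maps
  composed with a projection. Up to a global sign, each of the four remaining sums
  has the form
  \<open>\<Sum>\<^sub>i (-1)\<^sup>i f(p\<^sub>i)(p\<^sub>0,\<dots>,p\<^sub>i\<^sub>-\<^sub>1,p\<^sub>i\<^sub>+\<^sub>1,\<dots>,p\<^sub>n\<^sub>-\<^sub>1)\<close>
  with \<open>f(p)\<close> alternating multilinear and linear in \<open>p\<close>. Such a sum is multilinear, and it is
  alternating like the Laplace expansion of a determinant along a row
  (\<open>alternating_multilinear_laplace_sum\<close>): if \<open>p\<^sub>a = p\<^sub>b\<close> with \<open>a < b\<close>, only the terms \<open>i = a\<close>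
  and \<open>i = b\<close> survive, and their tuples differ by moving one entry past \<open>b - a - 1\<close> others, so
  that the two terms cancel (\<open>alternating_multilinear_move\<close>).
\<close>

section \<open>Alternating multilinear maps\<close>

lemma alternating_multilinearI:
  assumes "\<And>xs i. length xs = k \<Longrightarrow> i < k \<Longrightarrow> Vector_Spaces.linear s1 s2 (\<lambda>x. f (xs[i := x]))"
    and "\<And>xs i j. length xs = k \<Longrightarrow> i < j \<Longrightarrow> j < k \<Longrightarrow> xs ! i = xs ! j \<Longrightarrow> f xs = 0"
  shows "alternating_multilinear k s1 s2 f"
  using assms unfolding alternating_multilinear_def by blast

lemma alternating_multilinear_linear:
  assumes "alternating_multilinear k s1 s2 f" "length xs = k" "i < k"
  shows "Vector_Spaces.linear s1 s2 (\<lambda>x. f (xs[i := x]))"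
  using assms unfolding alternating_multilinear_def by blast

lemma alternating_multilinear_eq_0:
  assumes "alternating_multilinear k s1 s2 f" "length xs = k" "i < j" "j < k" "xs ! i = xs ! j"
  shows "f xs = 0"
  using assms unfolding alternating_multilinear_def by blast

lemma alternating_multilinear_add_middle:
  assumes "alternating_multilinear k s1 s2 f" "length (as @ x # bs) = k"
  shows "f (as @ (x + y) # bs) = f (as @ x # bs) + f (as @ y # bs)"
  using alternating_multilinear_linear[OF assms, of "length as"] assms(2)
  by (auto simp: Vector_Spaces.linear_iff)

lemma alternating_multilinear_swap:
  assumes f: "alternating_multilinear k s1 s2 f" and len: "length (as @ x # y # bs) = k"
  shows "f (as @ x # y # bs) = - f (as @ y # x # bs)"
proof -
  have eq_0: "f (as @ z # z # bs) = 0" for z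
    using f by (rule alternating_multilinear_eq_0[where i = "length as" and j = "Suc (length as)"])
      (use len in \<open>auto simp: nth_append\<close>)
  have left: "f (as @ (x + y) # z # bs) = f (as @ x # z # bs) + f (as @ y # z # bs)" for z
    using alternating_multilinear_add_middle[OF f, of as x "z # bs" y] len by simp
  have right: "f (as @ z # (x + y) # bs) = f (as @ z # x # bs) + f (as @ z # y # bs)" for z
    using alternating_multilinear_add_middle[OF f, of "as @ [z]" x bs y] len by simp
  (* Polarization: the bilinear expansion of f(x + y, x + y) = 0 has vanishing diagonal terms. *)
  have "0 = f (as @ (x + y) # (x + y) # bs)"
    by (simp only: eq_0)
  also have "\<dots> = f (as @ x # y # bs) + f (as @ y # x # bs)"
    by (simp only: left right) (simp add: eq_0)
  finally show ?thesis
    by (simp add: eq_neg_iff_add_eq_0)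
qed

text \<open>
  Moving an entry past the block \<open>bs\<close> is a product of \<open>length bs\<close> adjacent swaps.
\<close>

lemma alternating_multilinear_move:
  assumes f: "alternating_multilinear k s1 s2 f" and vs: "vector_space s2"
    and len: "length (as @ x # bs @ cs) = k"
  shows "f (as @ x # bs @ cs) = s2 ((- 1) ^ length bs) (f (as @ bs @ x # cs))"
  using len
proof (induction bs arbitrary: as)
  case Nil
  then show ?case
    using vs by (simp add: vector_space.vector_space_assms(4))
next
  case (Cons b bs)
  interpret vector_space s2 by fact
  have "f (as @ x # b # bs @ cs) = - f (as @ b # x # bs @ cs)"
    using Cons.prems by (intro alternating_multilinear_swap[OF f]) simp
  also have "\<dots> = - s2 ((- 1) ^ length bs) (f (as @ b # bs @ x # cs))"
    using Cons.IH[of "as @ [b]"] Cons.prems by simp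
  finally show ?case
    by simp
qed

lemma alternating_multilinear_comp_map:
  fixes h :: "'b::ab_group_add \<Rightarrow> 'c::ab_group_add"
  assumes f: "alternating_multilinear k s2 s3 f" and h: "Vector_Spaces.linear s1 s2 h"
  shows "alternating_multilinear k s1 s3 (\<lambda>ps. f (map h ps))"
proof (rule alternating_multilinearI)
  fix xs :: "'b list" and i assume "length xs = k" "i < k"
  then have "Vector_Spaces.linear s2 s3 (\<lambda>y. f ((map h xs)[i := y]))"
    by (intro alternating_multilinear_linear[OF f]) simp_all
  from Vector_Spaces.linear_compose[OF h this]
  show "Vector_Spaces.linear s1 s3 (\<lambda>x. f (map h (xs[i := x])))"
    by (simp add: map_update o_def)
next
  fix xs :: "'b list" and i j assume "length xs = k" "i < j" "j < k" "xs ! i = xs ! j"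
  then show "f (map h xs) = 0"
    by (intro alternating_multilinear_eq_0[OF f, of _ i j]) simp_all
qed

lemma alternating_multilinear_add:
  assumes "alternating_multilinear k s1 s2 f" "alternating_multilinear k s1 s2 g"
  shows "alternating_multilinear k s1 s2 (\<lambda>xs. f xs + g xs)"
  using assms unfolding alternating_multilinear_def Vector_Spaces.linear_iff
  by (simp add: vector_space.vector_space_assms(1) algebra_simps)

lemma alternating_multilinear_scale:
  assumes "alternating_multilinear k s1 s2 f" and "vector_space s2"
  shows "alternating_multilinear k s1 s2 (\<lambda>xs. s2 c (f xs))"
proof -
  interpret vector_space s2 by fact
  show ?thesis
    using assms unfolding alternating_multilinear_def Vector_Spaces.linear_iff
    by (simp add: algebra_simps)
qed

lemma alternating_multilinear_Pair:
  assumes "vector_space_pair s2 s3"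
    and "alternating_multilinear k s1 s2 f" "alternating_multilinear k s1 s3 g"
  shows "alternating_multilinear k s1 (module_prod.scale s2 s3) (\<lambda>xs. (f xs, g xs))"
proof -
  interpret vector_space_pair s2 s3 by fact
  interpret vector_space_prod s2 s3 by unfold_locales
  show ?thesis
    using assms(2,3) p.vector_space_axioms unfolding alternating_multilinear_def Vector_Spaces.linear_iff
    by (simp add: scale_prod zero_prod_def)
qed

section \<open>Alternating sums of Laplace type\<close>

lemma omit_append:
  "omit (length as) (as @ x # bs) = as @ bs"
  by (simp add: omit_def)

lemma length_omit:
  "i < length xs \<Longrightarrow> length (omit i xs) = length xs - 1"
  by (simp add: omit_def)

lemma map_omit:
  "map f (omit i xs) = omit i (map f xs)"
  by (simp add: omit_def take_map drop_map)

lemma nth_omit: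
  assumes "j \<noteq> i" "i < length xs" "j < length xs"
  shows "omit i xs ! (if j < i then j else j - 1) = xs ! j"
  using assms by (auto simp: omit_def nth_append)

lemma omit_update_same:
  "omit i (xs[i := x]) = omit i xs"
  by (simp add: omit_def)

lemma omit_update:
  assumes "j \<noteq> i" "i < length xs" "j < length xs"
  shows "omit i (xs[j := x]) = (omit i xs)[(if j < i then j else j - 1) := x]"
  using assms
  by (intro nth_equalityI) (auto simp: omit_def nth_append nth_list_update)

lemma split_list_at_two:
  assumes "a < b" "b < length xs"
  obtains as bs cs where "xs = as @ xs ! a # bs @ xs ! b # cs" "length as = a"
    "Suc (a + length bs) = b"
proof
  show "xs = take a xs @ xs ! a # drop (Suc a) (take b xs) @ xs ! b # drop (Suc b) xs"
  proof -
    have "take b xs = take a xs @ xs ! a # drop (Suc a) (take b xs)"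
      using assms id_take_nth_drop[of a "take b xs"] by (simp add: min_absorb1)
    then show ?thesis
      using id_take_nth_drop[OF assms(2)] by (metis append_assoc append_Cons)
  qed
qed (use assms in auto)

lemma linear_sum:
  assumes "vector_space s1" "vector_space s2" "\<And>i. i \<in> I \<Longrightarrow> Vector_Spaces.linear s1 s2 (f i)"
  shows "Vector_Spaces.linear s1 s2 (\<lambda>x. \<Sum>i\<in>I. f i x)"
  using assms vector_space_pair.linear_compose_sum[of s1 s2 I f]
  by (simp add: vector_space_pair_def)

lemma linear_scale_right:
  assumes "Vector_Spaces.linear s1 s2 f"
  shows "Vector_Spaces.linear s1 s2 (\<lambda>x. s2 c (f x))"
proof -
  interpret Vector_Spaces.linear s1 s2 f by fact
  show ?thesis
    by unfold_locales (simp_all add: add scale algebra_simps)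
qed

text \<open>
  The model case is \<open>f p ps = \<phi> p * g ps\<close> with a \<open>1\<close>-form \<open>\<phi>\<close> and an alternating
  \<open>(n-1)\<close>-form \<open>g\<close>, where the sum is the wedge product of \<open>\<phi>\<close> and \<open>g\<close>. If the entries
  of \<open>ps\<close> at \<open>a < b\<close> are equal, every other term still has both of them in \<open>omit i ps\<close> and vanishes,
  while the terms \<open>a\<close> and \<open>b\<close> cancel: their lists differ by a move past the \<open>b - a - 1\<close> entries
  in between.
\<close>

lemma alternating_multilinear_laplace_sum:
  fixes s1 :: "'k::field \<Rightarrow> 'b::ab_group_add \<Rightarrow> 'b"
  assumes vs1: "vector_space s1" and vs2: "vector_space s2"
    and lin: "\<And>ps. length ps = n - 1 \<Longrightarrow> Vector_Spaces.linear s1 s2 (\<lambda>p. f p ps)"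
    and alt: "\<And>p. alternating_multilinear (n - 1) s1 s2 (f p)"
  shows "alternating_multilinear n s1 s2 (\<lambda>ps. \<Sum>i<n. s2 ((- 1) ^ i) (f (ps ! i) (omit i ps)))"
proof (rule alternating_multilinearI)
  fix ps :: "'b list" and j assume len: "length ps = n" and j: "j < n"
  have "Vector_Spaces.linear s1 s2 (\<lambda>p. f (ps[j := p] ! i) (omit i (ps[j := p])))"
    if i: "i < n" for i
  proof (cases "j = i")
    case True
    then show ?thesis
      using lin[of "omit i ps"] i len by (simp add: omit_update_same length_omit)
  next
    case False
    then show ?thesis
      using alternating_multilinear_linear[OF alt, of "omit i ps" "if j < i then j else j - 1" "ps ! i"]
        i j len by (auto simp: omit_update length_omit)
  qed
  then show "Vector_Spaces.linear s1 s2
      (\<lambda>p. \<Sum>i<n. s2 ((- 1) ^ i) (f (ps[j := p] ! i) (omit i (ps[j := p]))))"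
    by (intro linear_sum[OF vs1 vs2] linear_scale_right) simp
next
  interpret vector_space s2 by fact
  fix ps :: "'b list" and a b
  assume len: "length ps = n" and ab: "a < b" "b < n" and eq: "ps ! a = ps ! b"
  let ?t = "\<lambda>i. s2 ((- 1) ^ i) (f (ps ! i) (omit i ps))"
  have zero: "?t i = 0" if "i \<in> {..<n} - {a, b}" for i
  proof -
    let ?a = "if a < i then a else a - 1" and ?b = "if b < i then b else b - 1"
    have "omit i ps ! ?a = ps ! a" "omit i ps ! ?b = ps ! b"
      by (rule nth_omit; use that ab len in auto)+
    then have "omit i ps ! ?a = omit i ps ! ?b"
      using eq by simp
    moreover have "?a < ?b" "?b < n - 1"
      using that ab by auto
    ultimately have "f (ps ! i) (omit i ps) = 0"
      using that len by (intro alternating_multilinear_eq_0[OF alt, of _ ?a ?b]) (auto simp: length_omit)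
    then show ?thesis
      by simp
  qed
  obtain as bs cs where ps: "ps = as @ ps ! a # bs @ ps ! a # cs"
    and a: "length as = a" and b: "Suc (a + length bs) = b"
    using split_list_at_two[of a b ps] ab len eq by metis
  have omit_a: "omit a ps = as @ bs @ ps ! a # cs"
    using omit_append[of as "ps ! a" "bs @ ps ! a # cs"] ps a by simp
  have omit_b: "omit b ps = as @ ps ! a # bs @ cs"
    using omit_append[of "as @ ps ! a # bs" "ps ! a" cs] ps a b by simp
  have "length (as @ ps ! a # bs @ cs) = n - 1"
    using arg_cong[OF ps, of length] len by simp
  then have "f (ps ! a) (omit b ps) = s2 ((- 1) ^ length bs) (f (ps ! a) (omit a ps))"
    using alternating_multilinear_move[OF alt vs2] by (simp add: omit_a omit_b)
  (* The sign of the move and that of the position multiply to - (-1)^a. *)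
  then have "?t b = s2 ((- 1) ^ b * (- 1) ^ length bs) (f (ps ! a) (omit a ps))"
    by (simp add: eq[symmetric])
  also have "(- 1) ^ b * (- 1) ^ length bs = - ((- 1 :: 'k) ^ a)"
    unfolding b[symmetric] by (simp add: power_add mult.assoc flip: power_mult_distrib)
  finally have "?t a + ?t b = 0"
    by simp
  moreover have "(\<Sum>i<n. ?t i) = (\<Sum>i\<in>{a, b}. ?t i)"
    using ab zero by (intro sum.mono_neutral_right) auto
  ultimately show "(\<Sum>i<n. ?t i) = 0"
    using ab by simp
qed

text \<open>
  The signs \<open>(-1)\<^sup>n\<^sup>-\<^sup>1\<^sup>-\<^sup>i\<close>, which count the position from the end of the tuple, differ from
  \<open>(-1)\<^sup>i\<close> by the factor \<open>(-1)\<^sup>n\<^sup>-\<^sup>1\<close>, the same for all \<open>i\<close>.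
\<close>

lemma alternating_multilinear_laplace_sum_rev:
  fixes s1 :: "'k::field \<Rightarrow> 'b::ab_group_add \<Rightarrow> 'b"
  assumes vs1: "vector_space s1" and vs2: "vector_space s2"
    and lin: "\<And>ps. length ps = n - 1 \<Longrightarrow> Vector_Spaces.linear s1 s2 (\<lambda>p. f p ps)"
    and alt: "\<And>p. alternating_multilinear (n - 1) s1 s2 (f p)"
  shows "alternating_multilinear n s1 s2
    (\<lambda>ps. \<Sum>i<n. s2 ((- 1) ^ (n - 1 - i)) (f (ps ! i) (omit i ps)))"
proof -
  interpret vector_space s2 by fact
  have sign: "(- 1 :: 'k) ^ (n - 1 - i) = (- 1) ^ (n - 1) * (- 1) ^ i" if "i < n" for i
  proof -
    have "(- 1 :: 'k) ^ (n - 1) = (- 1) ^ (n - 1 - i) * (- 1) ^ i"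
      using that by (simp flip: power_add)
    then show ?thesis
      by (simp add: mult.assoc flip: power_mult_distrib)
  qed
  have "(\<lambda>ps. \<Sum>i<n. s2 ((- 1) ^ (n - 1 - i)) (f (ps ! i) (omit i ps))) =
      (\<lambda>ps. s2 ((- 1) ^ (n - 1)) (\<Sum>i<n. s2 ((- 1) ^ i) (f (ps ! i) (omit i ps))))"
    by (simp only: scale_sum_right scale_scale) (intro ext sum.cong refl, simp only: lessThan_iff sign)
  then show ?thesis
    using alternating_multilinear_scale[OF alternating_multilinear_laplace_sum[OF assms] vs2] by simp
qed

section \<open>The bracket of an extreme action datum\<close>

lemma alternating_multilinear_action_bracket:
  assumes sg: "vector_space sg" and sV: "vector_space sV"
    and br: "alternating_multilinear n sg sg br" and \<Omega>: "extreme_action_datum n sg sV \<Omega>"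
  shows "alternating_multilinear n (module_prod.scale sg sV) (module_prod.scale sg sV)
    (action_bracket n sg sV br \<Omega>)"
proof -
  interpret vector_space_pair sg sV
    using sg sV by (simp add: vector_space_pair_def)
  interpret vector_space_prod sg sV
    by unfold_locales
  note vs = p.vector_space_axioms
  have datum:
    "\<And>xs. length xs = n - 1 \<Longrightarrow> Vector_Spaces.linear sV sV (rho_g \<Omega> xs)"
    "\<And>u. alternating_multilinear (n - 1) sg sV (\<lambda>xs. rho_g \<Omega> xs u)"
    "\<And>us. length us = n - 1 \<Longrightarrow> Vector_Spaces.linear sg sg (rho_V \<Omega> us)"
    "\<And>x. alternating_multilinear (n - 1) sV sg (\<lambda>us. rho_V \<Omega> us x)"
    "\<And>u. alternating_multilinear (n - 1) sg sg (theta_V \<Omega> u)"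
    "\<And>xs. length xs = n - 1 \<Longrightarrow> Vector_Spaces.linear sV sg (\<lambda>u. theta_V \<Omega> u xs)"
    "\<And>x. alternating_multilinear (n - 1) sV sV (theta_g \<Omega> x)"
    "\<And>us. length us = n - 1 \<Longrightarrow> Vector_Spaces.linear sg sV (\<lambda>x. theta_g \<Omega> x us)"
    "alternating_multilinear n sV sg (omega \<Omega>)"
    "alternating_multilinear n sV sV (curly_V \<Omega>)"
    using \<Omega> unfolding extreme_action_datum_def by blast+
  note comp_fst = Vector_Spaces.linear_compose[OF linear_fst, unfolded o_def]
    and comp_snd = Vector_Spaces.linear_compose[OF linear_snd, unfolded o_def]
    and map_fst = alternating_multilinear_comp_map[OF _ linear_fst]
    and map_snd = alternating_multilinear_comp_map[OF _ linear_snd]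
  have theta_V: "alternating_multilinear n scale sg
      (\<lambda>ps. \<Sum>i<n. sg ((- 1) ^ i) (theta_V \<Omega> (snd (ps ! i)) (map fst (omit i ps))))"
    by (rule alternating_multilinear_laplace_sum[OF vs sg])
      (rule comp_snd map_fst datum | simp)+
  have rho_V: "alternating_multilinear n scale sg
      (\<lambda>ps. \<Sum>i<n. sg ((- 1) ^ (n - 1 - i)) (rho_V \<Omega> (map snd (omit i ps)) (fst (ps ! i))))"
    by (rule alternating_multilinear_laplace_sum_rev[OF vs sg, where f = "\<lambda>p ps. rho_V \<Omega> (map snd ps) (fst p)"])
      (rule comp_fst map_snd[where f = "\<lambda>us. rho_V \<Omega> us _"] datum | simp)+
  have rho_g: "alternating_multilinear n scale sV
      (\<lambda>ps. \<Sum>i<n. sV ((- 1) ^ (n - 1 - i)) (rho_g \<Omega> (map fst (omit i ps)) (snd (ps ! i))))"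
    by (rule alternating_multilinear_laplace_sum_rev[OF vs sV, where f = "\<lambda>p ps. rho_g \<Omega> (map fst ps) (snd p)"])
      (rule comp_snd map_fst[where f = "\<lambda>xs. rho_g \<Omega> xs _"] datum | simp)+
  have theta_g: "alternating_multilinear n scale sV
      (\<lambda>ps. \<Sum>i<n. sV ((- 1) ^ (n - 1 - i)) (theta_g \<Omega> (fst (ps ! i)) (map snd (omit i ps))))"
    by (rule alternating_multilinear_laplace_sum_rev[OF vs sV])
      (rule comp_fst map_snd datum | simp)+
  let ?G = "\<lambda>ps. br (map fst ps) + omega \<Omega> (map snd ps)
      + (\<Sum>i<n. sg ((- 1) ^ i) (theta_V \<Omega> (snd (ps ! i)) (map fst (omit i ps))))
      + (\<Sum>i<n. sg ((- 1) ^ (n - 1 - i)) (rho_V \<Omega> (map snd (omit i ps)) (fst (ps ! i))))"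
  let ?H = "\<lambda>ps. curly_V \<Omega> (map snd ps)
      + (\<Sum>i<n. sV ((- 1) ^ (n - 1 - i)) (rho_g \<Omega> (map fst (omit i ps)) (snd (ps ! i))))
      + (\<Sum>i<n. sV ((- 1) ^ (n - 1 - i)) (theta_g \<Omega> (fst (ps ! i)) (map snd (omit i ps))))"
  have alt: "alternating_multilinear n scale scale (\<lambda>ps. (?G ps, ?H ps))"
    by (intro alternating_multilinear_Pair alternating_multilinear_add theta_V rho_V rho_g theta_g
        map_fst[OF br] map_snd[OF datum(9)] map_snd[OF datum(10)] vector_space_pair_axioms)
  have "action_bracket n sg sV br \<Omega> ps = (?G ps, ?H ps)" if "length ps = n" for ps
    using that by (simp add: action_bracket_def action_G_def action_H_def Let_def map_omit)
  then show ?thesis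
    using alt unfolding alternating_multilinear_def by simp
qed

theorem theorem3p3:
  fixes sg :: "'k::field_char_0 \<Rightarrow> 'g::ab_group_add \<Rightarrow> 'g"
    and sV :: "'k \<Rightarrow> 'v::ab_group_add \<Rightarrow> 'v"
    and n :: nat
    and br :: "'g list \<Rightarrow> 'g"
    and \<Omega> :: "('g, 'v) action_datum"
  defines "G \<equiv> action_G n sg br \<Omega>"
    and "H \<equiv> action_H n sV \<Omega>"
  assumes "n_Lie_algebra sg n br"
    and "vector_space sV"
    and "extreme_action_datum n sg sV \<Omega>"
  shows "n_Lie_bracket n (module_prod.scale sg sV) (action_bracket n sg sV br \<Omega>) \<longleftrightarrow>
    (\<forall>ps qs. length ps = n - 1 \<longrightarrow> length qs = n \<longrightarrow>
      (let G0 = G qs; H0 = H qs;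
           Gi = (\<lambda>i. G (ps @ [qs ! i])); Hi = (\<lambda>i. H (ps @ [qs ! i]))
       in G (ps @ [(G0, H0)]) = (\<Sum>i<n. G (qs[i := (Gi i, Hi i)])) \<and>
          H (ps @ [(G0, H0)]) = (\<Sum>i<n. H (qs[i := (Gi i, Hi i)]))))"
proof -
  have "vector_space sg" "n_Lie_bracket n sg br"
    using \<open>n_Lie_algebra sg n br\<close>
    by (simp_all add: n_Lie_algebra_def n_Lie_algebra_axioms_def)
  then have "alternating_multilinear n (module_prod.scale sg sV) (module_prod.scale sg sV)
      (action_bracket n sg sV br \<Omega>)"
    using assms(4,5)
    by (intro alternating_multilinear_action_bracket) (simp_all add: n_Lie_bracket_def)
  moreover have "action_bracket n sg sV br \<Omega> = (\<lambda>ps. (G ps, H ps))"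
    by (simp add: fun_eq_iff action_bracket_def G_def H_def)
  ultimately show ?thesis
    by (simp add: n_Lie_bracket_def Let_def sum_prod)
qed

end
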